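(* Let $\beta\in(1,2)$. If $\beta$ is not a root of any non-zero polynomial (of finite degree) with coefficients in $\{-1,0,1\}$, then for all $\alpha\in[0,2-\beta]$ the intermediate $\beta$-shift $\Omega_{\beta,\alpha}$ is not a subshift of finite type.
   Context: For $\beta\in(1,2)$, $0\le\alpha\le2-\beta$ and $p=(1-\alpha)/\beta$, the maps $T^{\pm}_{\beta,\alpha}:[0,1]\to[0,1]$ ($x\mapsto\beta x+\alpha \bmod 1$) are: $T^{+}_{\beta,\alpha}(x)=\beta x+\alpha$ if $x<p$ and $\beta x+\alpha-1$ if $x\ge p$; $T^{-}_{\beta,\alpha}(x)=\beta x+\alpha$ if $x\le p$ and $\beta x+\alpha-1$ if $x>p$. The expansion $\tau^{+}_{\beta,\alpha}(x)=(\omega_1,\omega_2,\dots)\in\{0,1\}^{\mathbb{N}}$ has $\omega_n=0$ if $(T^{+}_{\beta,\alpha})^{n-1}(x)<p$ and $\omega_n=1$ otherwise; $\tau^{-}_{\beta,\alpha}(x)$ has $\omega_n=0$ if $(T^{-}_{\beta,\alpha})^{n-1}(x)\le p$ and $\omega_n=1$ otherwise. Set $\Omega^{+}_{\beta,\alpha}=\tau^{+}_{\beta,\alpha}([0,1))$, $\Omega^{-}_{\beta,\alpha}=\tau^{-}_{\beta,\alpha}((0,1])$ and $\Omega_{\beta,\alpha}=\Omega^{+}_{\beta,\alpha}\cup\Omega^{-}_{\beta,\alpha}$. $\{0,1\}^{\mathbb{N}}$ carries the product topology and $\sigma$ is the left shift. A subshift is a closed set $\Omega\subseteq\{0,1\}^{\mathbb{N}}$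 with $\sigma(\Omega)\subseteq\Omega$. $\Omega|^{*}$ denotes the set of all finite non-empty words that are prefixes of elements of $\Omega$. A subshift $\Omega$ is a subshift of finite type if there is $M\in\mathbb{N}$ such that for all $(\omega_1,\dots,\omega_n),(\xi_1,\dots,\xi_m)\in\Omega|^{*}$ with $n\ge M$: $(\omega_{n-M+1},\dots,\omega_n,\xi_1,\dots,\xi_m)\in\Omega|^{*}$ if and only if $(\omega_1,\dots,\omega_n,\xi_1,\dots,\xi_m)\in\Omega|^{*}$. *)

theory Defs
  imports "HOL-Analysis.Analysis" "HOL-Computational_Algebra.Polynomial"
begin

definition crit_pt :: "real \<Rightarrow> real \<Rightarrow> real" where
  "crit_pt \<beta> \<alpha> = (1 - \<alpha>) / \<beta>"

definition T_plus :: "real \<Rightarrow> real \<Rightarrow> real \<Rightarrow> real" where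
  "T_plus \<beta> \<alpha> x = (if x < crit_pt \<beta> \<alpha> then \<beta> * x + \<alpha> else \<beta> * x + \<alpha> - 1)"

definition T_minus :: "real \<Rightarrow> real \<Rightarrow> real \<Rightarrow> real" where
  "T_minus \<beta> \<alpha> x = (if x \<le> crit_pt \<beta> \<alpha> then \<beta> * x + \<alpha> else \<beta> * x + \<alpha> - 1)"

text \<open>Sequences are indexed from 0: the value at \<open>n\<close> is the \<open>(n + 1)\<close>-st digit.\<close>

definition tau_plus :: "real \<Rightarrow> real \<Rightarrow> real \<Rightarrow> nat \<Rightarrow> nat" where
  "tau_plus \<beta> \<alpha> x n = (if (T_plus \<beta> \<alpha> ^^ n) x < crit_pt \<beta> \<alpha> then 0 else 1)"

definition tau_minus :: "real \<Rightarrow> real \<Rightarrow> real \<Rightarrow> nat \<Rightarrow> nat" where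
  "tau_minus \<beta> \<alpha> x n = (if (T_minus \<beta> \<alpha> ^^ n) x \<le> crit_pt \<beta> \<alpha> then 0 else 1)"

definition Omega_plus :: "real \<Rightarrow> real \<Rightarrow> (nat \<Rightarrow> nat) set" where
  "Omega_plus \<beta> \<alpha> = tau_plus \<beta> \<alpha> ` {0..<1}"

definition Omega_minus :: "real \<Rightarrow> real \<Rightarrow> (nat \<Rightarrow> nat) set" where
  "Omega_minus \<beta> \<alpha> = tau_minus \<beta> \<alpha> ` {0<..1}"

definition Omega :: "real \<Rightarrow> real \<Rightarrow> (nat \<Rightarrow> nat) set" where
  "Omega \<beta> \<alpha> = Omega_plus \<beta> \<alpha> \<union> Omega_minus \<beta> \<alpha>"

definition left_shift :: "(nat \<Rightarrow> nat) \<Rightarrow> (nat \<Rightarrow> nat)" where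
  "left_shift w = (\<lambda>n. w (Suc n))"

definition full_shift_top :: "(nat \<Rightarrow> nat) topology" where
  "full_shift_top = product_topology (\<lambda>_. discrete_topology {0, 1}) UNIV"

text \<open>\<open>closedin\<close> includes that the set consists of 0-1 sequences.\<close>

definition subshift :: "(nat \<Rightarrow> nat) set \<Rightarrow> bool" where
  "subshift X \<longleftrightarrow> closedin full_shift_top X \<and> left_shift ` X \<subseteq> X"

definition prefix_words :: "(nat \<Rightarrow> nat) set \<Rightarrow> nat list set" where
  "prefix_words X = {map w [0..<n] | w n. w \<in> X \<and> n \<ge> 1}"

text \<open>The word \<open>drop (length u - M) u\<close> consists of the last \<open>M\<close> letters of \<open>u\<close>.\<close>

definition subshift_of_finite_type :: "(nat \<Rightarrow> nat) set \<Rightarrow> bool" where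
  "subshift_of_finite_type X \<longleftrightarrow> subshift X \<and>
     (\<exists>M\<ge>1. \<forall>u\<in>prefix_words X. \<forall>v\<in>prefix_words X. length u \<ge> M \<longrightarrow>
        (drop (length u - M) u @ v \<in> prefix_words X \<longleftrightarrow> u @ v \<in> prefix_words X))"

end

theory Submission
  imports Defs
begin

text \<open>
  Let \<open>p\<close> be the critical point. If \<open>\<Omega>\<close> has memory \<open>M\<close>, then \<open>p\<close> returns to itself under \<open>T\<^sup>-\<close>
  (unless \<open>\<alpha> = 2 - \<beta>\<close>): otherwise the points slightly to the right of \<open>y = (T\<^sup>-)\<^sup>2 p\<close> share the first
  \<open>M\<close> digits of \<open>y\<close>, so by the memory property their continuations could be appended to the first
  \<open>M + 2\<close> digits of \<open>p\<close>; but a point with these digits lies to the left of \<open>p\<close>, and the expansion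
  by the factor \<open>\<beta>\<close> makes this impossible. The conjugation \<open>x \<mapsto> 1 - x\<close> exchanges \<open>T\<^sup>-\<close> with \<open>T\<^sup>+\<close> and
  \<open>\<alpha>\<close> with \<open>2 - \<beta> - \<alpha>\<close>, so \<open>p\<close> also returns to itself under \<open>T\<^sup>+\<close> unless \<open>\<alpha> = 0\<close>.
  The difference of the two orbits of \<open>p\<close> after \<open>n\<close> steps is a polynomial in \<open>\<beta>\<close> whose coefficients
  are the differences of the digits; it vanishes at a common period. If \<open>\<alpha> = 0\<close>, then the
  \<open>T\<^sup>+\<close>-orbit of \<open>p\<close> stays at \<open>0\<close>, and the difference equals \<open>p = 1 / \<beta>\<close> at a period of the other orbit.
\<close>

section \<open>Memory condition and recursions for orbits\<close>

definition has_memory :: "nat \<Rightarrow> (nat \<Rightarrow> nat) set \<Rightarrow> bool" where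
  "has_memory M X \<longleftrightarrow> (\<forall>u\<in>prefix_words X. \<forall>v\<in>prefix_words X. length u \<ge> M \<longrightarrow>
     (drop (length u - M) u @ v \<in> prefix_words X \<longleftrightarrow> u @ v \<in> prefix_words X))"

lemma T_plus_Suc:
  "(T_plus \<beta> \<alpha> ^^ Suc n) x = \<beta> * (T_plus \<beta> \<alpha> ^^ n) x + \<alpha> - real (tau_plus \<beta> \<alpha> x n)"
  by (simp add: T_plus_def tau_plus_def)

lemma T_minus_Suc:
  "(T_minus \<beta> \<alpha> ^^ Suc n) x = \<beta> * (T_minus \<beta> \<alpha> ^^ n) x + \<alpha> - real (tau_minus \<beta> \<alpha> x n)"
  by (simp add: T_minus_def tau_minus_def)

lemma tau_minus_funpow:
  "tau_minus \<beta> \<alpha> ((T_minus \<beta> \<alpha> ^^ k) x) n = tau_minus \<beta> \<alpha> x (k + n)"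
  by (simp add: tau_minus_def funpow_add add.commute[of k])

lemma funpow_fixed_mult:
  assumes "(f ^^ n) x = x"
  shows "(f ^^ (n * k)) x = x"
  by (induction k) (simp_all add: funpow_add assms)

text \<open>Equal digits apply the same affine map to both sequences, so each step multiplies the
  gap by \<beta>. Plain sequences cover orbits under either map.\<close>

lemma orbit_diff:
  fixes a b :: "nat \<Rightarrow> real" and d :: "nat \<Rightarrow> nat"
  assumes "\<And>n. n < m \<Longrightarrow> a (Suc n) = \<beta> * a n + \<alpha> - d n"
    and "\<And>n. n < m \<Longrightarrow> b (Suc n) = \<beta> * b n + \<alpha> - d n"
  shows "a m - b m = \<beta> ^ m * (a 0 - b 0)"
  using assms
proof (induction m)
  case (Suc m)
  then have "a m - b m = \<beta> ^ m * (a 0 - b 0)"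
    by simp
  moreover have "a (Suc m) - b (Suc m) = \<beta> * (a m - b m)"
    using Suc.prems[of m] by (simp add: algebra_simps)
  ultimately show ?case
    by simp
qed simp

section \<open>The two maps on the unit interval\<close>

context
  fixes \<beta> \<alpha> :: real
  assumes \<beta>: "1 < \<beta>" "\<beta> < 2" and \<alpha>: "0 \<le> \<alpha>" "\<alpha> \<le> 2 - \<beta>"
begin

lemma crit_pt_eq: "\<beta> * crit_pt \<beta> \<alpha> + \<alpha> = 1"
  using \<beta> by (simp add: crit_pt_def)

lemma crit_pt_pos: "0 < crit_pt \<beta> \<alpha>" and crit_pt_less_1: "crit_pt \<beta> \<alpha> < 1"
  using \<beta> \<alpha> by (simp_all add: crit_pt_def)

lemma le_crit_pt_iff: "x \<le> crit_pt \<beta> \<alpha> \<longleftrightarrow> \<beta> * x + \<alpha> \<le> 1"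
  using \<beta> by (simp add: crit_pt_def field_simps)

lemma less_crit_pt_iff: "x < crit_pt \<beta> \<alpha> \<longleftrightarrow> \<beta> * x + \<alpha> < 1"
  using \<beta> by (simp add: crit_pt_def field_simps)

lemma T_plus_mem:
  assumes "x \<in> {0..<1}"
  shows "T_plus \<beta> \<alpha> x \<in> {0..<1}"
proof -
  have "\<beta> * x < \<beta>" "0 \<le> \<beta> * x"
    using assms \<beta> by auto
  then show ?thesis
    using \<alpha> by (auto simp: T_plus_def less_crit_pt_iff)
qed

lemma T_minus_mem:
  assumes "x \<in> {0<..1}"
  shows "T_minus \<beta> \<alpha> x \<in> {0<..1}"
proof -
  have "\<beta> * x \<le> \<beta>" "0 < \<beta> * x"
    using assms \<beta> by auto
  then show ?thesis
    using \<alpha> by (auto simp: T_minus_def le_crit_pt_iff)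
qed

lemma T_plus_funpow_mem: "x \<in> {0..<1} \<Longrightarrow> (T_plus \<beta> \<alpha> ^^ n) x \<in> {0..<1}"
  by (induction n) (use T_plus_mem in auto)

lemma T_minus_funpow_mem: "x \<in> {0<..1} \<Longrightarrow> (T_minus \<beta> \<alpha> ^^ n) x \<in> {0<..1}"
  by (induction n) (use T_minus_mem in auto)

lemma tau_minus_in_Omega: "x \<in> {0<..1} \<Longrightarrow> tau_minus \<beta> \<alpha> x \<in> Omega \<beta> \<alpha>"
  by (auto simp: Omega_def Omega_minus_def)

text \<open>Allows words of \<open>Omega\<close> to be handled without splitting into
  \<open>T_plus\<close> and \<open>T_minus\<close>: the weak bound at digit 0 is common to
  both.\<close>

lemma Omega_orbit:
  assumes "w \<in> Omega \<beta> \<alpha>"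
  obtains b where "\<And>n. 0 \<le> b n" "\<And>n. b n \<le> 1"
    "\<And>n. b (Suc n) = \<beta> * b n + \<alpha> - w n" "\<And>n. w n = 0 \<Longrightarrow> b n \<le> crit_pt \<beta> \<alpha>"
proof -
  consider x where "x \<in> {0..<1}" "w = tau_plus \<beta> \<alpha> x" | x where "x \<in> {0<..1}" "w = tau_minus \<beta> \<alpha> x"
    using assms by (auto simp: Omega_def Omega_plus_def Omega_minus_def)
  then show thesis
  proof cases
    case 1
    then show thesis
      using T_plus_funpow_mem[OF 1(1)]
      by (intro that[of "\<lambda>n. (T_plus \<beta> \<alpha> ^^ n) x"])
        (auto simp del: funpow.simps simp: T_plus_Suc tau_plus_def less_imp_le split: if_splits)
  next
    case 2
    then show thesis
      using T_minus_funpow_mem[OF 2(1)]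
      by (intro that[of "\<lambda>n. (T_minus \<beta> \<alpha> ^^ n) x"])
        (auto simp del: funpow.simps simp: T_minus_Suc tau_minus_def less_imp_le split: if_splits)
  qed
qed

section \<open>Return of the critical point under \<open>T_minus\<close>\<close>

text \<open>Finitely many iterates that avoid the critical point leave room for a small shift that
  changes no digit.\<close>

lemma T_minus_perturb_right:
  assumes "\<And>i. i < m \<Longrightarrow> (T_minus \<beta> \<alpha> ^^ i) y \<noteq> crit_pt \<beta> \<alpha>"
  shows "\<exists>e>0. \<forall>\<epsilon>. 0 < \<epsilon> \<longrightarrow> \<epsilon> \<le> e \<longrightarrow>
    (\<forall>i\<le>m. (T_minus \<beta> \<alpha> ^^ i) (y + \<epsilon>) = (T_minus \<beta> \<alpha> ^^ i) y + \<beta> ^ i * \<epsilon>) \<and>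
    (\<forall>i<m. tau_minus \<beta> \<alpha> (y + \<epsilon>) i = tau_minus \<beta> \<alpha> y i)"
  using assms
proof (induction m)
  case 0
  then show ?case
    by (intro exI[of _ 1]) auto
next
  case (Suc m)
  let ?p = "crit_pt \<beta> \<alpha>" and ?y = "(T_minus \<beta> \<alpha> ^^ m) y"
  obtain e where e: "e > 0" and
    orbit: "\<And>\<epsilon> i. 0 < \<epsilon> \<Longrightarrow> \<epsilon> \<le> e \<Longrightarrow> i \<le> m \<Longrightarrow>
      (T_minus \<beta> \<alpha> ^^ i) (y + \<epsilon>) = (T_minus \<beta> \<alpha> ^^ i) y + \<beta> ^ i * \<epsilon>" and
    digit: "\<And>\<epsilon> i. 0 < \<epsilon> \<Longrightarrow> \<epsilon> \<le> e \<Longrightarrow> i < m \<Longrightarrow> tau_minus \<beta> \<alpha> (y + \<epsilon>) i = tau_minus \<beta> \<alpha> y i"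
    using Suc.IH Suc.prems by (metis less_Suc_eq)
  \<comment> \<open>Only an iterate left of \<open>?p\<close> limits the shift: it may move up to
    \<open>?p\<close> itself, which still has digit 0 under \<open>T_minus\<close>. An iterate right
    of \<open>?p\<close> only moves further away.\<close>
  define e' where "e' = (if ?y < ?p then min e ((?p - ?y) / \<beta> ^ m) else e)"
  have "e' > 0" "e' \<le> e"
    using e \<beta> by (auto simp: e'_def)
  have digit': "tau_minus \<beta> \<alpha> (y + \<epsilon>) m = tau_minus \<beta> \<alpha> y m" if "0 < \<epsilon>" "\<epsilon> \<le> e'" for \<epsilon>
  proof -
    have shift: "(T_minus \<beta> \<alpha> ^^ m) (y + \<epsilon>) = ?y + \<beta> ^ m * \<epsilon>"
      using orbit that \<open>e' \<le> e\<close> by simp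
    have "?y \<noteq> ?p"
      using Suc.prems by simp
    then consider "?y < ?p" | "?p < ?y"
      by linarith
    then show ?thesis
    proof cases
      case 1
      then have "\<epsilon> \<le> (?p - ?y) / \<beta> ^ m"
        using that by (simp add: e'_def)
      then have "?y + \<beta> ^ m * \<epsilon> \<le> ?p"
        using \<beta> by (simp add: field_simps)
      then show ?thesis
        using 1 by (simp add: tau_minus_def shift)
    next
      case 2
      moreover have "0 < \<beta> ^ m * \<epsilon>"
        using \<beta> that by simp
      ultimately have "\<not> ?y + \<beta> ^ m * \<epsilon> \<le> ?p" "\<not> ?y \<le> ?p"
        by linarith+
      then show ?thesis
        by (simp add: tau_minus_def shift)
    qed
  qed
  have orbit': "(T_minus \<beta> \<alpha> ^^ Suc m) (y + \<epsilon>) = (T_minus \<beta> \<alpha> ^^ Suc m) y + \<beta> ^ Suc m * \<epsilon>"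
    if "0 < \<epsilon>" "\<epsilon> \<le> e'" for \<epsilon>
    unfolding T_minus_Suc digit'[OF that]
    using orbit[of \<epsilon> m] that \<open>e' \<le> e\<close> by (simp add: algebra_simps)
  show ?case
    using \<open>e' > 0\<close> \<open>e' \<le> e\<close> orbit orbit' digit digit'
    by (intro exI[of _ e']) (auto simp del: funpow.simps simp: le_Suc_eq less_Suc_eq)
qed

lemma crit_pt_T_minus_periodic:
  assumes "\<alpha> \<noteq> 2 - \<beta>" and mem: "has_memory M (Omega \<beta> \<alpha>)"
  shows "\<exists>j\<ge>1. (T_minus \<beta> \<alpha> ^^ j) (crit_pt \<beta> \<alpha>) = crit_pt \<beta> \<alpha>"
proof (rule ccontr)
  define p T \<tau> where "p = crit_pt \<beta> \<alpha>" and "T = T_minus \<beta> \<alpha>" and "\<tau> = tau_minus \<beta> \<alpha>"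
  assume "\<not> ?thesis"
  then have not_periodic: "(T ^^ j) p \<noteq> p" if "j \<ge> 1" for j
    using that by (auto simp: p_def T_def)
  have p: "p \<in> {0<..1}" "p < 1"
    using crit_pt_pos crit_pt_less_1 by (auto simp: p_def)
  \<comment> \<open>One step leads to 1, which has no points of the interval to its right; the
    second leads to \<beta> + \<alpha> - 1, which is below 1 because \<alpha> differs from 2 -
    \<beta>.\<close>
  define y where "y = (T ^^ 2) p"
  have T_mem: "(T ^^ n) x \<in> {0<..1}" if "x \<in> {0<..1}" for n x
    using T_minus_funpow_mem that by (simp add: T_def)
  have "T p = 1"
    by (simp add: T_def T_minus_def p_def crit_pt_eq)
  moreover have "T 1 = \<beta> + \<alpha> - 1"
    using p by (simp add: T_def T_minus_def p_def)
  ultimately have "y < 1"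
    using assms(1) \<alpha> by (simp add: y_def numeral_2_eq_2)
  have "0 < y"
    using T_mem p by (auto simp: y_def)
  have y_funpow: "(T ^^ n) y = (T ^^ (n + 2)) p" for n
    by (simp only: y_def funpow_add o_apply)
  obtain e where e: "e > 0"
    and e_orbit: "\<And>\<epsilon> i. 0 < \<epsilon> \<Longrightarrow> \<epsilon> \<le> e \<Longrightarrow> i \<le> M \<Longrightarrow> (T ^^ i) (y + \<epsilon>) = (T ^^ i) y + \<beta> ^ i * \<epsilon>"
    and e_digit: "\<And>\<epsilon> i. 0 < \<epsilon> \<Longrightarrow> \<epsilon> \<le> e \<Longrightarrow> i < M \<Longrightarrow> \<tau> (y + \<epsilon>) i = \<tau> y i"
    using T_minus_perturb_right[of M y] not_periodic y_funpow unfolding p_def T_def \<tau>_def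
    by (metis le_add2 one_le_numeral order_trans)
  \<comment> \<open>The cap \<open>1 - y\<close> keeps \<open>z\<close> in the interval.\<close>
  define \<epsilon> where "\<epsilon> = min e (1 - y)"
  define z where "z = y + \<epsilon>"
  have "\<epsilon> > 0" "\<epsilon> \<le> e" and z: "z \<in> {0<..1}"
    using e \<open>0 < y\<close> \<open>y < 1\<close> by (auto simp: \<epsilon>_def z_def)
  define z' where "z' = (T ^^ M) z"
  have z': "z' \<in> {0<..1}" "z' = (T ^^ (M + 2)) p + \<beta> ^ M * \<epsilon>"
    using T_mem[OF z, of M] e_orbit[of \<epsilon> M] \<open>\<epsilon> > 0\<close> \<open>\<epsilon> \<le> e\<close>
    by (simp_all add: z'_def z_def y_funpow)
  \<comment> \<open>After \<open>m\<close> further steps the gap \<beta>^M * \<epsilon> would exceed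
    the length of the interval. Passing to \<open>Suc m0\<close> makes \<open>v\<close>
    non-empty.\<close>
  obtain m0 where "1 / (\<beta> ^ M * \<epsilon>) < \<beta> ^ m0"
    using real_arch_pow \<beta> by blast
  also have "\<beta> ^ m0 \<le> \<beta> ^ Suc m0"
    using \<beta> by (intro power_increasing) auto
  finally obtain m where m: "m \<ge> 1" "1 < \<beta> ^ m * (\<beta> ^ M * \<epsilon>)"
    using \<beta> \<open>\<epsilon> > 0\<close> that[of "Suc m0"] by (simp add: field_simps)
  define u v where "u = map (\<tau> p) [0..<M + 2]" and "v = map (\<tau> z') [0..<m]"
  have words: "map (\<tau> x) [0..<n] \<in> prefix_words (Omega \<beta> \<alpha>)" if "x \<in> {0<..1}" "n \<ge> 1" for x n
    using that tau_minus_in_Omega by (auto simp: prefix_words_def \<tau>_def)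
  have "drop 2 u = map (\<tau> z) [0..<M]"
  proof (rule nth_equalityI)
    fix i assume "i < length (drop 2 u)"
    then have "i < M"
      by (simp add: u_def)
    then show "drop 2 u ! i = map (\<tau> z) [0..<M] ! i"
      using e_digit[of \<epsilon> i] \<open>\<epsilon> > 0\<close> \<open>\<epsilon> \<le> e\<close> tau_minus_funpow[of \<beta> \<alpha> 2 p i]
      by (simp add: u_def z_def y_def \<tau>_def T_def del: upt_Suc)
  qed (simp add: u_def)
  \<comment> \<open>The last \<open>M\<close> letters of \<open>u\<close> are the first
    \<open>M\<close> digits of \<open>z\<close>, and \<open>v\<close> continues with the digits of
    \<open>z'\<close>; so the shortened word is a prefix of the expansion of
    \<open>z\<close>.\<close>
  then have "drop 2 u @ v = map (\<tau> z) [0..<M + m]"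
    by (intro nth_equalityI)
      (auto simp: v_def z'_def \<tau>_def T_def tau_minus_funpow nth_append)
  then have "drop (length u - M) u @ v \<in> prefix_words (Omega \<beta> \<alpha>)"
    using words z m by (simp add: u_def)
  moreover have "u \<in> prefix_words (Omega \<beta> \<alpha>)" "v \<in> prefix_words (Omega \<beta> \<alpha>)"
    unfolding u_def v_def by (intro words; use p z' m in simp)+
  ultimately have "u @ v \<in> prefix_words (Omega \<beta> \<alpha>)"
    using mem by (auto simp: has_memory_def u_def)
  then obtain w n where w: "w \<in> Omega \<beta> \<alpha>" and uv: "u @ v = map w [0..<n]"
    by (auto simp: prefix_words_def)
  have n: "n = M + 2 + m"
    using arg_cong[OF uv, of length] by (simp add: u_def v_def)
  have w_u: "w i = \<tau> p i" if "i < M + 2" for i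
    using arg_cong[OF uv, of "\<lambda>l. l ! i"] that n by (simp add: u_def v_def nth_append del: upt_Suc)
  have w_v: "w (M + 2 + i) = \<tau> z' i" if "i < m" for i
    using arg_cong[OF uv, of "\<lambda>l. l ! (M + 2 + i)"] that n
    by (simp add: u_def v_def nth_append del: upt_Suc)
  obtain b where b: "\<And>n. 0 \<le> b n" "\<And>n. b n \<le> 1"
    "\<And>n. b (Suc n) = \<beta> * b n + \<alpha> - w n" "\<And>n. w n = 0 \<Longrightarrow> b n \<le> p"
    using Omega_orbit[OF w] unfolding p_def by metis
  \<comment> \<open>The first digit of \<open>p\<close> under \<open>T_minus\<close> is 0.\<close>
  have "b 0 \<le> p"
    using w_u[of 0] b(4) by (simp add: \<tau>_def tau_minus_def p_def)
  \<comment> \<open>Along \<open>u\<close> the orbit \<open>b\<close> shares the digits of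
    \<open>p\<close>, so it cannot overtake the orbit of \<open>p\<close>, whereas \<open>z'\<close>
    lies \<beta>^M * \<epsilon> to the right of that orbit.\<close>
  have "b (M + 2) - (T ^^ (M + 2)) p = \<beta> ^ (M + 2) * (b 0 - (T ^^ 0) p)"
    using w_u b(3) T_minus_Suc[of _ \<beta> \<alpha> p]
    by (intro orbit_diff[where d = w and \<alpha> = \<alpha>]) (simp_all add: T_def \<tau>_def del: funpow.simps)
  also have "\<dots> \<le> 0"
    using \<open>b 0 \<le> p\<close> \<beta> by (simp add: mult_le_0_iff)
  finally have "\<beta> ^ M * \<epsilon> \<le> z' - b (M + 2)"
    using z' by simp
  then have "\<beta> ^ m * (\<beta> ^ M * \<epsilon>) \<le> \<beta> ^ m * (z' - b (M + 2))"
    using \<beta> by (intro mult_left_mono) auto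
  \<comment> \<open>Along \<open>v\<close> the orbit \<open>b\<close> shares the digits of
    \<open>z'\<close>, so their gap grows by the factor \<beta>^m although both stay in the
    interval.\<close>
  also have "\<beta> ^ m * ((T ^^ 0) z' - b (M + 2 + 0)) = (T ^^ m) z' - b (M + 2 + m)"
    using w_v b(3) T_minus_Suc[of _ \<beta> \<alpha> z']
    by (intro orbit_diff[where d = "\<lambda>i. w (M + 2 + i)" and \<alpha> = \<alpha>, symmetric])
      (simp_all add: T_def \<tau>_def del: funpow.simps)
  then have "\<beta> ^ m * (z' - b (M + 2)) = (T ^^ m) z' - b (M + 2 + m)"
    by simp
  also have "\<dots> \<le> 1"
    using T_mem[OF z'(1), of m] b(1)[of "M + 2 + m"] by simp
  finally show False
    using m by simp
qed

section \<open>Reflection of the interval and of the digits\<close>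

lemma crit_pt_reflect: "crit_pt \<beta> (2 - \<beta> - \<alpha>) = 1 - crit_pt \<beta> \<alpha>"
  using \<beta> by (simp add: crit_pt_def field_simps)

lemma T_minus_reflect: "T_minus \<beta> (2 - \<beta> - \<alpha>) (1 - x) = 1 - T_plus \<beta> \<alpha> x"
  unfolding T_minus_def T_plus_def crit_pt_reflect by (auto simp: algebra_simps)

lemma T_plus_reflect: "T_plus \<beta> (2 - \<beta> - \<alpha>) (1 - x) = 1 - T_minus \<beta> \<alpha> x"
  unfolding T_minus_def T_plus_def crit_pt_reflect by (auto simp: algebra_simps)

lemma T_minus_funpow_reflect:
  "(T_minus \<beta> (2 - \<beta> - \<alpha>) ^^ n) (1 - x) = 1 - (T_plus \<beta> \<alpha> ^^ n) x"
  by (induction n) (simp_all add: T_minus_reflect)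

lemma T_plus_funpow_reflect:
  "(T_plus \<beta> (2 - \<beta> - \<alpha>) ^^ n) (1 - x) = 1 - (T_minus \<beta> \<alpha> ^^ n) x"
  by (induction n) (simp_all add: T_plus_reflect)

lemma Omega_reflect:
  assumes "w \<in> Omega \<beta> \<alpha>"
  shows "(\<lambda>n. 1 - w n) \<in> Omega \<beta> (2 - \<beta> - \<alpha>)"
proof -
  have "(\<lambda>n. 1 - tau_plus \<beta> \<alpha> x n) = tau_minus \<beta> (2 - \<beta> - \<alpha>) (1 - x)" for x
    by (auto simp: tau_minus_def tau_plus_def T_minus_funpow_reflect crit_pt_reflect)
  moreover have "(\<lambda>n. 1 - tau_minus \<beta> \<alpha> x n) = tau_plus \<beta> (2 - \<beta> - \<alpha>) (1 - x)" for x
    by (auto simp: tau_minus_def tau_plus_def T_plus_funpow_reflect crit_pt_reflect)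
  ultimately show ?thesis
    using assms by (auto simp: Omega_def Omega_plus_def Omega_minus_def)
qed

lemma prefix_words_reflect:
  assumes "u \<in> prefix_words (Omega \<beta> \<alpha>)"
  shows "map (\<lambda>d. 1 - d) u \<in> prefix_words (Omega \<beta> (2 - \<beta> - \<alpha>))"
proof -
  obtain w n where "w \<in> Omega \<beta> \<alpha>" "n \<ge> 1" "u = map w [0..<n]"
    using assms by (auto simp: prefix_words_def)
  then have "map (\<lambda>d. 1 - d) u = map (\<lambda>i. 1 - w i) [0..<n]"
    by simp
  then show ?thesis
    using Omega_reflect \<open>w \<in> _\<close> \<open>n \<ge> 1\<close> unfolding prefix_words_def by blast
qed

lemma prefix_words_Omega_binary: "u \<in> prefix_words (Omega \<beta> \<alpha>) \<Longrightarrow> set u \<subseteq> {0, 1}"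
  by (auto simp: prefix_words_def Omega_def Omega_plus_def Omega_minus_def
      tau_plus_def tau_minus_def)

end

text \<open>Subtraction of naturals truncates, so \<open>1 - d\<close> is an involution only on the
  digits 0 and 1.\<close>

lemma map_reflect_reflect:
  assumes "set u \<subseteq> {0, 1 :: nat}"
  shows "map (\<lambda>d. 1 - d) (map (\<lambda>d. 1 - d) u) = u"
  using assms by (auto intro!: map_idI)

lemma prefix_words_reflect_iff:
  assumes "1 < \<beta>" "\<beta> < 2" "0 \<le> \<alpha>" "\<alpha> \<le> 2 - \<beta>" and "set u \<subseteq> {0, 1}"
  shows "map (\<lambda>d. 1 - d) u \<in> prefix_words (Omega \<beta> (2 - \<beta> - \<alpha>)) \<longleftrightarrow>
    u \<in> prefix_words (Omega \<beta> \<alpha>)"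
proof
  assume "map (\<lambda>d. 1 - d) u \<in> prefix_words (Omega \<beta> (2 - \<beta> - \<alpha>))"
  \<comment> \<open>Reflecting the parameter is an involution too, so the converse is the same lemma
    at 2 - \<beta> - \<alpha>.\<close>
  then have "map (\<lambda>d. 1 - d) (map (\<lambda>d. 1 - d) u) \<in> prefix_words (Omega \<beta> (2 - \<beta> - (2 - \<beta> - \<alpha>)))"
    using assms by (intro prefix_words_reflect[where \<alpha> = "2 - \<beta> - \<alpha>"]) auto
  then show "u \<in> prefix_words (Omega \<beta> \<alpha>)"
    unfolding map_reflect_reflect[OF assms(5)] by simp
qed (rule prefix_words_reflect[OF assms(1-4)])

lemma has_memory_reflect:
  assumes \<beta>\<alpha>: "1 < \<beta>" "\<beta> < 2" "0 \<le> \<alpha>" "\<alpha> \<le> 2 - \<beta>"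
    and mem: "has_memory M (Omega \<beta> \<alpha>)"
  shows "has_memory M (Omega \<beta> (2 - \<beta> - \<alpha>))"
  unfolding has_memory_def
proof (intro ballI impI)
  let ?f = "map (\<lambda>d. 1 - d :: nat)" and ?P = "prefix_words (Omega \<beta> \<alpha>)"
    and ?P' = "prefix_words (Omega \<beta> (2 - \<beta> - \<alpha>))"
  fix u v assume u: "u \<in> ?P'" and v: "v \<in> ?P'" and "M \<le> length u"
  have binary: "set u \<subseteq> {0, 1}" "set v \<subseteq> {0, 1}"
    using u v \<beta>\<alpha> by (auto dest!: prefix_words_Omega_binary[rotated -1])
  have binary': "set (drop k u) \<subseteq> {0, 1}" for k
    using binary set_drop_subset by fast
  \<comment> \<open>The equivalence is applied to \<open>?f x\<close>; reflecting twice gives back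
    \<open>x\<close>.\<close>
  have iff: "x \<in> ?P' \<longleftrightarrow> ?f x \<in> ?P" if "set x \<subseteq> {0, 1}" for x
  proof -
    have "set (?f x) \<subseteq> {0, 1}"
      by auto
    from prefix_words_reflect_iff[OF \<beta>\<alpha> this] show ?thesis
      unfolding map_reflect_reflect[OF that] by blast
  qed
  have "drop (length (?f u) - M) (?f u) @ ?f v \<in> ?P \<longleftrightarrow> ?f u @ ?f v \<in> ?P"
    using mem u v \<open>M \<le> length u\<close> iff binary unfolding has_memory_def by (metis length_map)
  moreover have "drop (length u - M) u @ v \<in> ?P' \<longleftrightarrow> ?f (drop (length u - M) u @ v) \<in> ?P"
    "u @ v \<in> ?P' \<longleftrightarrow> ?f (u @ v) \<in> ?P"
    using binary binary' by (intro iff; simp)+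
  ultimately show "drop (length u - M) u @ v \<in> ?P' \<longleftrightarrow> u @ v \<in> ?P'"
    by (simp add: drop_map)
qed

text \<open>At the reflected parameter the exceptional case of the \<open>T_minus\<close> result
  becomes \<alpha> = 0.\<close>

lemma crit_pt_T_plus_periodic:
  assumes \<beta>\<alpha>: "1 < \<beta>" "\<beta> < 2" "0 \<le> \<alpha>" "\<alpha> \<le> 2 - \<beta>" and "\<alpha> \<noteq> 0"
    and mem: "has_memory M (Omega \<beta> \<alpha>)"
  shows "\<exists>j\<ge>1. (T_plus \<beta> \<alpha> ^^ j) (crit_pt \<beta> \<alpha>) = crit_pt \<beta> \<alpha>"
proof -
  have "\<exists>j\<ge>1. (T_minus \<beta> (2 - \<beta> - \<alpha>) ^^ j) (crit_pt \<beta> (2 - \<beta> - \<alpha>)) = crit_pt \<beta> (2 - \<beta> - \<alpha>)"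
    using assms has_memory_reflect[OF \<beta>\<alpha> mem]
    by (intro crit_pt_T_minus_periodic) auto
  then show ?thesis
    using \<beta>\<alpha> by (simp add: crit_pt_reflect T_minus_funpow_reflect)
qed

section \<open>Orbit differences as polynomials in \<beta>\<close>

definition height_one_poly :: "real poly \<Rightarrow> bool" where
  "height_one_poly q \<longleftrightarrow> q \<noteq> 0 \<and> (\<forall>i. coeff q i \<in> {-1, 0, 1})"

lemma height_one_poly_pCons:
  assumes "height_one_poly q" "c \<in> {-1, 0, 1}"
  shows "height_one_poly (pCons c q)"
  using assms by (auto simp: height_one_poly_def coeff_pCons split: nat.splits)

text \<open>One step sends the critical point to 1 under \<open>T_minus\<close> and to 0 under
  \<open>T_plus\<close>, which gives the constant polynomial 1. In each later step \<alpha> cancels,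
  and multiplying by \<beta> and adding the digit difference is a \<open>pCons\<close>.\<close>

lemma height_one_poly_orbit_diff:
  assumes "1 < \<beta>" "\<beta> < 2" "0 \<le> \<alpha>" "\<alpha> \<le> 2 - \<beta>"
  shows "\<exists>q. height_one_poly q \<and>
    poly q \<beta> = (T_minus \<beta> \<alpha> ^^ Suc n) (crit_pt \<beta> \<alpha>) - (T_plus \<beta> \<alpha> ^^ Suc n) (crit_pt \<beta> \<alpha>)"
proof (induction n)
  case 0
  have "height_one_poly 1"
    by (auto simp: height_one_poly_def)
  then show ?case
    by (intro exI[of _ 1]) (simp add: T_minus_def T_plus_def)
next
  case (Suc n)
  let ?p = "crit_pt \<beta> \<alpha>"
  let ?c = "real (tau_plus \<beta> \<alpha> ?p (Suc n)) - real (tau_minus \<beta> \<alpha> ?p (Suc n))"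
  obtain q where q: "height_one_poly q"
    "poly q \<beta> = (T_minus \<beta> \<alpha> ^^ Suc n) ?p - (T_plus \<beta> \<alpha> ^^ Suc n) ?p"
    using Suc by blast
  have "?c \<in> {-1, 0, 1}"
    by (auto simp: tau_plus_def tau_minus_def)
  then have "height_one_poly (pCons ?c q)"
    using q(1) by (rule height_one_poly_pCons[rotated])
  moreover have "poly (pCons ?c q) \<beta> =
      (T_minus \<beta> \<alpha> ^^ Suc (Suc n)) ?p - (T_plus \<beta> \<alpha> ^^ Suc (Suc n)) ?p"
    unfolding T_minus_Suc[of "Suc n"] T_plus_Suc[of "Suc n"]
    by (simp add: q(2) algebra_simps del: funpow.simps)
  ultimately show ?case
    by blast
qed

lemma height_one_root_if_has_memory_0:
  assumes \<beta>: "1 < \<beta>" "\<beta> < 2" and mem: "has_memory M (Omega \<beta> 0)"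
  shows "\<exists>q. height_one_poly q \<and> poly q \<beta> = 0"
proof -
  let ?p = "crit_pt \<beta> 0"
  obtain j where "j \<ge> 1" "(T_minus \<beta> 0 ^^ j) ?p = ?p"
    using crit_pt_T_minus_periodic[OF \<beta> _ _ _ mem] \<beta> by auto
  then obtain n where n: "(T_minus \<beta> 0 ^^ Suc n) ?p = ?p"
    by (cases j) auto
  \<comment> \<open>For \<alpha> = 0 the map \<open>T_plus\<close> sends the critical point to the
    fixed point 0.\<close>
  have "(T_plus \<beta> 0 ^^ Suc k) ?p = 0" for k
    using \<beta> by (induction k) (auto simp: T_plus_def crit_pt_def)
  then obtain q where q: "height_one_poly q" "poly q \<beta> = ?p"
    using height_one_poly_orbit_diff[OF \<beta>, of 0 n] \<beta> n by auto
  \<comment> \<open>Since \<open>q\<close> takes the value 1 / \<beta> at \<beta>, the polynomial X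
    * q - 1 vanishes there.\<close>
  then have "height_one_poly (pCons (-1) q)"
    by (intro height_one_poly_pCons) auto
  moreover have "poly (pCons (-1) q) \<beta> = 0"
    using q(2) \<beta> by (simp add: crit_pt_def)
  ultimately show ?thesis
    by blast
qed

lemma height_one_root_if_has_memory:
  assumes \<beta>\<alpha>: "1 < \<beta>" "\<beta> < 2" "0 \<le> \<alpha>" "\<alpha> \<le> 2 - \<beta>"
    and mem: "has_memory M (Omega \<beta> \<alpha>)"
  shows "\<exists>q. height_one_poly q \<and> poly q \<beta> = 0"
proof -
  let ?p = "crit_pt \<beta> \<alpha>"
  consider "\<alpha> = 0" | "\<alpha> = 2 - \<beta>" | "\<alpha> \<noteq> 0" "\<alpha> \<noteq> 2 - \<beta>"
    by blast
  then show ?thesis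
  proof cases
    case 1
    then show ?thesis
      using height_one_root_if_has_memory_0 \<beta>\<alpha> mem by blast
  next
    case 2
    then show ?thesis
      using height_one_root_if_has_memory_0 \<beta>\<alpha> has_memory_reflect[OF \<beta>\<alpha> mem] by simp
  next
    case 3
    obtain j k where jk: "j \<ge> 1" "(T_minus \<beta> \<alpha> ^^ j) ?p = ?p" "k \<ge> 1" "(T_plus \<beta> \<alpha> ^^ k) ?p = ?p"
      using crit_pt_T_minus_periodic[OF \<beta>\<alpha> 3(2) mem] crit_pt_T_plus_periodic[OF \<beta>\<alpha> 3(1) mem] by blast
    \<comment> \<open>The product of the two periods is a common period; it is positive, as the
      polynomial exists only from the first step on.\<close>
    then obtain n where "j * k = Suc n"
      by (metis mult_is_0 not0_implies_Suc not_one_le_zero)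
    then have "(T_minus \<beta> \<alpha> ^^ Suc n) ?p = ?p" "(T_plus \<beta> \<alpha> ^^ Suc n) ?p = ?p"
      using funpow_fixed_mult[OF jk(2), of k] funpow_fixed_mult[OF jk(4), of j]
      by (simp_all add: mult.commute del: funpow.simps)
    then show ?thesis
      using height_one_poly_orbit_diff[OF \<beta>\<alpha>, of n] by simp
  qed
qed

theorem corollary1:
  fixes \<beta> :: real
  assumes "1 < \<beta>" and "\<beta> < 2"
    and "\<not> (\<exists>q :: real poly. q \<noteq> 0 \<and> (\<forall>i. coeff q i \<in> {-1, 0, 1}) \<and> poly q \<beta> = 0)"
  shows "\<forall>\<alpha>\<in>{0..2 - \<beta>}. \<not> subshift_of_finite_type (Omega \<beta> \<alpha>)"
proof (intro ballI notI)
  fix \<alpha> assume "\<alpha> \<in> {0..2 - \<beta>}" "subshift_of_finite_type (Omega \<beta> \<alpha>)"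
  moreover from this obtain M where "has_memory M (Omega \<beta> \<alpha>)"
    unfolding subshift_of_finite_type_def has_memory_def by blast
  ultimately show False
    using height_one_root_if_has_memory[of \<beta> \<alpha> M] assms by (auto simp: height_one_poly_def)
qed

end
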